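(* Let $p,q\ge 0$ be integers with $n=p+q\ge 1$. a) The subspace $\overline{\mathbf{02}}=\mathcal{C}\!\ell^{\mathbb R}_{even}(p,q)$ is a subalgebra of the real Clifford algebra $\mathcal{C}\!\ell^{\mathbb R}(p,q)$. b) Each of the following subspaces is a subalgebra (closed under the Clifford product) of the complex Clifford algebra $\mathcal{C}\!\ell^{\mathbb C}(p,q)$: $$\overline{\mathbf{02}}=\mathcal{C}\!\ell^{\mathbb R}_{even}(p,q),\qquad \overline{\mathbf{02}}\oplus i\,\overline{\mathbf{02}}=\mathcal{C}\!\ell^{\mathbb C}_{even}(p,q),$$ $$\overline{\mathbf{02}}\oplus i\,\overline{\mathbf{13}}=\mathcal{C}\!\ell^{\mathbb R}_{even}(p,q)\oplus i\,\mathcal{C}\!\ell^{\mathbb R}_{odd}(p,q),\qquad \overline{\mathbf{0123}}=\mathcal{C}\!\ell^{\mathbb R}(p,q).$$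
   Context: $\mathcal{C}\!\ell^{\mathbb F}(p,q)$ ($\mathbb F=\mathbb R$ or $\mathbb C$) is the Clifford algebra over $\mathbb F$ with identity $e$ and generators $e^1,\dots,e^n$, $n=p+q$, satisfying $e^ae^b+e^be^a=2\eta^{ab}e$, where $\eta$ is diagonal with $p$ entries $+1$ followed by $q$ entries $-1$. The $2^n$ elements $e$ and $e^{a_1\ldots a_k}=e^{a_1}\cdots e^{a_k}$ ($a_1<\dots<a_k$, $1\le k\le n$) form an $\mathbb F$-basis. $\mathcal{C}\!\ell^{\mathbb F}_k(p,q)$ is the $\mathbb F$-span of the basis elements with $k$ indices (rank $k$; $k=0$ means the span of $e$), and it is zero for $k>n$. $\mathcal{C}\!\ell^{\mathbb F}_{even}$ (resp. $\mathcal{C}\!\ell^{\mathbb F}_{odd}$) is the direct sum of the $\mathcal{C}\!\ell^{\mathbb F}_k$ with $k$ even (resp. odd). We regard $\mathcal{C}\!\ell^{\mathbb R}(p,q)\subset\mathcal{C}\!\ell^{\mathbb C}(p,q)=\mathcal{C}\!\ell^{\mathbb R}(p,q)\oplus i\,\mathcal{C}\!\ell^{\mathbb R}(p,q)$. For $k\in\{0,1,2,3\}$, $\overline{\mathbf k}=\bigoplus_{j\equiv k \,(\mathrm{mod}\,4)}\mathcal{C}\!\ell^{\mathbb R}_j(p,q)$; $\overline{\mathbf{kl}}=\overline{\mathbf k}\oplus\overline{\mathbf l}$, and $\overline{\mathbf{0123}}=\overline{\mathbf 0}\oplus\overline{\mathbf 1}\oplus\overline{\mathbf 2}\oplus\overline{\mathbf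 3}$. All these are real vector spaces; subspaces and subalgebras of $\mathcal{C}\!\ell^{\mathbb C}(p,q)$ are understood over $\mathbb R$. *)

theory Defs
  imports Complex_Main "HOL-Library.Set_Algebras" "HOL-Library.Function_Algebras"
begin

text \<open>
  An algebra is carried by a linear subspace of an ambient vector space, so that a complex Clifford
  algebra and the real Clifford algebra inside it live in the same type and are instances of the
  same locale. The generators are \<open>gen A 1, \<dots>, gen A n\<close>; other values of \<open>gen A\<close> are irrelevant.
\<close>

record ('f, 'a) gen_algebra =
  carrier :: "'a set"
  smul :: "'f \<Rightarrow> 'a \<Rightarrow> 'a"
  mult :: "'a \<Rightarrow> 'a \<Rightarrow> 'a"
  ident :: "'a"
  gen :: "nat \<Rightarrow> 'a"

abbreviation lspan :: "('f::field_char_0, 'a::ab_group_add) gen_algebra \<Rightarrow> 'a set \<Rightarrow> 'a set" where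
  "lspan A \<equiv> module.span (smul A)"

text \<open>The ordered product of the generators with indices in \<open>I\<close>; the empty product is the identity.\<close>

definition blade :: "('f, 'a) gen_algebra \<Rightarrow> nat set \<Rightarrow> 'a" where
  "blade A I = foldr (\<lambda>a x. mult A (gen A a) x) (sorted_list_of_set I) (ident A)"

definition eta :: "nat \<Rightarrow> nat \<Rightarrow> nat \<Rightarrow> 'f::field_char_0" where
  "eta p a b = (if a = b then (if a \<le> p then 1 else - 1) else 0)"

locale clifford_algebra = vector_space "smul A"
  for A :: "('f::field_char_0, 'a::ab_group_add) gen_algebra" and p q :: nat +
  assumes mult_closed: "\<lbrakk>x \<in> carrier A; y \<in> carrier A\<rbrakk> \<Longrightarrow> mult A x y \<in> carrier A"
    and mult_assoc: "\<lbrakk>x \<in> carrier A; y \<in> carrier A; z \<in> carrier A\<rbrakk>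
          \<Longrightarrow> mult A (mult A x y) z = mult A x (mult A y z)"
    and mult_add_left: "\<lbrakk>x \<in> carrier A; y \<in> carrier A; z \<in> carrier A\<rbrakk>
          \<Longrightarrow> mult A (x + y) z = mult A x z + mult A y z"
    and mult_add_right: "\<lbrakk>x \<in> carrier A; y \<in> carrier A; z \<in> carrier A\<rbrakk>
          \<Longrightarrow> mult A x (y + z) = mult A x y + mult A x z"
    and mult_smul_left: "\<lbrakk>x \<in> carrier A; y \<in> carrier A\<rbrakk>
          \<Longrightarrow> mult A (smul A c x) y = smul A c (mult A x y)"
    and mult_smul_right: "\<lbrakk>x \<in> carrier A; y \<in> carrier A\<rbrakk>
          \<Longrightarrow> mult A x (smul A c y) = smul A c (mult A x y)"
    and ident_closed: "ident A \<in> carrier A"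
    and ident_left: "x \<in> carrier A \<Longrightarrow> mult A (ident A) x = x"
    and ident_right: "x \<in> carrier A \<Longrightarrow> mult A x (ident A) = x"
    and gen_closed: "a \<in> {1..p+q} \<Longrightarrow> gen A a \<in> carrier A"
    and gen_anticomm: "\<lbrakk>a \<in> {1..p+q}; b \<in> {1..p+q}\<rbrakk>
          \<Longrightarrow> mult A (gen A a) (gen A b) + mult A (gen A b) (gen A a)
                = smul A (2 * eta p a b) (ident A)"
    and blade_inj: "inj_on (blade A) (Pow {1..p+q})"
    and blade_independent: "independent (blade A ` Pow {1..p+q})"
    and blade_span: "carrier A = span (blade A ` Pow {1..p+q})"

definition rank_space :: "nat \<Rightarrow> ('f::field_char_0, 'a::ab_group_add) gen_algebra \<Rightarrow> nat \<Rightarrow> 'a set" where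
  "rank_space n A k = lspan A (blade A ` {I. I \<subseteq> {1..n} \<and> card I = k})"

text \<open>
  The sum of the rank subspaces with rank in \<open>J\<close>. The sum is direct in a Clifford algebra, see
  \<open>graded_sum_disjoint\<close> below; in the statement \<open>+\<close> on subspaces is \<open>{x + y | x \<in> U, y \<in> V}\<close>.
\<close>

definition graded_sum :: "nat \<Rightarrow> ('f::field_char_0, 'a::ab_group_add) gen_algebra \<Rightarrow> nat set \<Rightarrow> 'a set" where
  "graded_sum n A J = lspan A (\<Union>k\<in>J. rank_space n A k)"

definition even_part :: "nat \<Rightarrow> ('f::field_char_0, 'a::ab_group_add) gen_algebra \<Rightarrow> 'a set" where
  "even_part n A = graded_sum n A {k. even k}"

definition odd_part :: "nat \<Rightarrow> ('f::field_char_0, 'a::ab_group_add) gen_algebra \<Rightarrow> 'a set" where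
  "odd_part n A = graded_sum n A {k. odd k}"

definition quat :: "nat \<Rightarrow> ('f::field_char_0, 'a::ab_group_add) gen_algebra \<Rightarrow> nat \<Rightarrow> 'a set" where
  "quat n A k = graded_sum n A {j. j mod 4 = k}"

definition is_direct_sum :: "'a::ab_group_add set \<Rightarrow> 'a set \<Rightarrow> 'a set \<Rightarrow> bool" where
  "is_direct_sum S U V \<longleftrightarrow> S = U + V \<and> U \<inter> V = {0}"

definition is_subalgebra :: "'a set \<Rightarrow> ('f::field_char_0, 'a::ab_group_add) gen_algebra \<Rightarrow> bool" where
  "is_subalgebra S A \<longleftrightarrow>
     S \<subseteq> carrier A \<and> module.subspace (smul A) S \<and> (\<forall>x\<in>S. \<forall>y\<in>S. mult A x y \<in> S)"

text \<open>A complex algebra seen as a real one (same elements), and the real span of its blades.\<close>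

definition restrict_real :: "(complex, 'a) gen_algebra \<Rightarrow> (real, 'a) gen_algebra" where
  "restrict_real A = \<lparr>carrier = carrier A, smul = (\<lambda>r. smul A (complex_of_real r)),
     mult = mult A, ident = ident A, gen = gen A\<rparr>"

definition real_form :: "nat \<Rightarrow> (complex, 'a::ab_group_add) gen_algebra \<Rightarrow> (real, 'a) gen_algebra" where
  "real_form n A = (restrict_real A)
     \<lparr>carrier := lspan (restrict_real A) (blade A ` Pow {1..n})\<rparr>"

definition i_times :: "(complex, 'a) gen_algebra \<Rightarrow> 'a set \<Rightarrow> 'a set" where
  "i_times A S = smul A \<i> ` S"


lemma blade_empty: "blade A {} = ident A"
  by (simp add: blade_def)

lemma blade_insert:
  assumes "finite I" "\<forall>i\<in>I. a < i"
  shows "blade A (insert a I) = mult A (gen A a) (blade A I)"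
proof -
  have "Min (insert a I) = a"
    using assms by (intro Min_eqI) (auto intro: less_imp_le)
  moreover have "insert a I - {a} = I"
    using assms by auto
  ultimately have "sorted_list_of_set (insert a I) = a # sorted_list_of_set I"
    using sorted_list_of_set_nonempty[of "insert a I"] assms by simp
  then show ?thesis by (simp add: blade_def)
qed

context clifford_algebra
begin

lemma carrier_subspace: "subspace (carrier A)"
  by (simp add: blade_span)

lemma carrier_zero: "0 \<in> carrier A"
  and carrier_add: "x \<in> carrier A \<Longrightarrow> y \<in> carrier A \<Longrightarrow> x + y \<in> carrier A"
  and carrier_smul: "x \<in> carrier A \<Longrightarrow> smul A c x \<in> carrier A"
  and carrier_neg: "x \<in> carrier A \<Longrightarrow> - x \<in> carrier A"
  using carrier_subspace by (simp_all add: subspace_0 subspace_add subspace_scale subspace_neg)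

lemma blade_closed: "I \<subseteq> {1..p+q} \<Longrightarrow> blade A I \<in> carrier A"
  unfolding blade_span by (intro span_base) auto

lemma mult_neg_left: "x \<in> carrier A \<Longrightarrow> y \<in> carrier A \<Longrightarrow> mult A (- x) y = - mult A x y"
  using mult_smul_left[of x y "-1"] by simp

lemma mult_neg_right: "x \<in> carrier A \<Longrightarrow> y \<in> carrier A \<Longrightarrow> mult A x (- y) = - mult A x y"
  using mult_smul_right[of x y "-1"] by simp

lemma mult_zero_left: "x \<in> carrier A \<Longrightarrow> mult A 0 x = 0"
  using mult_smul_left[of x x 0] by simp

lemma mult_zero_right: "x \<in> carrier A \<Longrightarrow> mult A x 0 = 0"
  using mult_smul_right[of x x 0] by simp

lemma graded_sum_eq:
  "graded_sum (p+q) A J = span (blade A ` {I. I \<subseteq> {1..p+q} \<and> card I \<in> J})" (is "_ = span ?B")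
proof
  have "rank_space (p+q) A k \<subseteq> span ?B" if "k \<in> J" for k
    unfolding rank_space_def using that by (intro span_mono) auto
  then show "graded_sum (p+q) A J \<subseteq> span ?B"
    unfolding graded_sum_def by (intro span_minimal) auto
  have "?B \<subseteq> (\<Union>k\<in>J. rank_space (p+q) A k)"
  proof
    fix x assume "x \<in> ?B"
    then obtain I where I: "x = blade A I" "I \<subseteq> {1..p+q}" "card I \<in> J" by auto
    then have "x \<in> rank_space (p+q) A (card I)"
      unfolding rank_space_def by (intro span_base) auto
    then show "x \<in> (\<Union>k\<in>J. rank_space (p+q) A k)" using I by blast
  qed
  then show "span ?B \<subseteq> graded_sum (p+q) A J"
    unfolding graded_sum_def by (rule span_mono)
qed

text \<open>Sums of different ranks are direct.\<close>

lemma graded_sum_disjoint: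
  assumes "J \<inter> K = {}"
  shows "graded_sum (p+q) A J \<inter> graded_sum (p+q) A K = {0}"
proof -
  let ?B = "blade A ` Pow {1..p+q}"
  let ?S = "\<lambda>J. blade A ` {I. I \<subseteq> {1..p+q} \<and> card I \<in> J}"
  have sub: "?S J \<subseteq> ?B" for J by auto
  have dis: "?S J \<inter> ?S K = {}"
  proof -
    have "I = I'" if "blade A I = blade A I'" "I \<subseteq> {1..p+q}" "I' \<subseteq> {1..p+q}" for I I'
      using inj_onD[OF blade_inj that(1)] that by simp
    then show ?thesis using assms by blast
  qed
  have "x = 0" if x: "x \<in> span (?S J)" "x \<in> span (?S K)" for x
  proof -
    note ind = independent_mono[OF blade_independent sub]
    have eq: "representation ?B x = representation (?S J) x"
             "representation ?B x = representation (?S K) x"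
      by (rule representation_extend[OF blade_independent _ sub], fact)+
    have "representation (?S J) x v = 0" for v
    proof (rule ccontr)
      assume J: "representation (?S J) x v \<noteq> 0"
      then have K: "representation (?S K) x v \<noteq> 0"
        using eq by simp
      have "v \<in> ?S J \<inter> ?S K"
        by (intro IntI representation_ne_zero[OF J] representation_ne_zero[OF K])
      then show False unfolding dis by simp
    qed
    then show ?thesis
      using sum_nonzero_representation_eq[OF ind x(1)] by simp
  qed
  then show ?thesis
    unfolding graded_sum_eq using span_zero by blast
qed

lemma gen_square:
  assumes a: "a \<in> {1..p+q}"
  shows "mult A (gen A a) (gen A a) = smul A (eta p a a) (ident A)"
proof -
  let ?x = "mult A (gen A a) (gen A a)"
  have "smul A 2 ?x = ?x + ?x"
    using scale_left_distrib[of 1 1 ?x] by simp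
  also have "\<dots> = smul A 2 (smul A (eta p a a) (ident A))"
    using gen_anticomm[OF a a] by simp
  finally show ?thesis
    by (simp only: scale_cancel_left) simp
qed

lemma gen_swap:
  assumes "a \<in> {1..p+q}" "b \<in> {1..p+q}" "a \<noteq> b"
  shows "mult A (gen A a) (gen A b) = - mult A (gen A b) (gen A a)"
  using gen_anticomm[OF assms(1,2)] assms(3) by (simp add: eta_def eq_neg_iff_add_eq_0)

lemma gen_blade:
  assumes I: "I \<subseteq> {1..p+q}" and a: "a \<in> {1..p+q}"
  shows "\<exists>J. J \<subseteq> {1..p+q} \<and> J \<subseteq> insert a I \<and>
           mult A (gen A a) (blade A I) \<in> {blade A J, - blade A J}"
proof -
  have "finite I" using I finite_subset by blast
  then show ?thesis using I
  proof (induction I rule: finite_linorder_min_induct)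
    case empty
    have "mult A (gen A a) (blade A {}) = blade A {a}"
      using blade_insert[of "{}" a A] by simp
    then show ?case using a by (intro exI[of _ "{a}"]) simp
  next
    case (insert b I)
    have b: "b \<in> {1..p+q}" and I: "I \<subseteq> {1..p+q}" using insert.prems by auto
    note cl = gen_closed[OF a] gen_closed[OF b] blade_closed[OF I]
    have bI: "blade A (insert b I) = mult A (gen A b) (blade A I)"
      using insert.hyps by (intro blade_insert) auto
    consider "a < b" | "a = b" | "b < a" by linarith
    then show ?case
    proof cases
      case 1
      then have "mult A (gen A a) (blade A (insert b I)) = blade A (insert a (insert b I))"
        using insert.hyps by (intro blade_insert[symmetric]) auto
      then show ?thesis using a b I by (intro exI[of _ "insert a (insert b I)"]) simp
    next
      case 2
      have "mult A (gen A a) (blade A (insert b I)) = mult A (mult A (gen A a) (gen A a)) (blade A I)"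
        unfolding bI unfolding 2[symmetric] using cl by (intro mult_assoc[symmetric])
      also have "\<dots> = smul A (eta p a a) (blade A I)"
        using cl by (simp add: gen_square[OF a] mult_smul_left ident_closed ident_left)
      finally have "mult A (gen A a) (blade A (insert b I)) \<in> {blade A I, - blade A I}"
        by (simp add: eta_def)
      then show ?thesis using I by blast
    next
      case 3
      obtain J where J: "J \<subseteq> {1..p+q}" "J \<subseteq> insert a I"
        and aI: "mult A (gen A a) (blade A I) \<in> {blade A J, - blade A J}"
        using insert.IH[OF I] by blast
      have "mult A (gen A a) (blade A (insert b I)) = mult A (mult A (gen A a) (gen A b)) (blade A I)"
        unfolding bI using cl by (intro mult_assoc[symmetric])
      also have "\<dots> = mult A (- mult A (gen A b) (gen A a)) (blade A I)"
        using gen_swap[OF a b] 3 by simp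
      also have "\<dots> = - mult A (gen A b) (mult A (gen A a) (blade A I))"
        using cl by (simp add: mult_neg_left mult_closed mult_assoc)
      finally have *: "mult A (gen A a) (blade A (insert b I)) =
          - mult A (gen A b) (mult A (gen A a) (blade A I))" .
      have bJ: "mult A (gen A b) (blade A J) = blade A (insert b J)"
        using J 3 insert.hyps finite_subset[OF J(1)]
        by (intro blade_insert[symmetric]) auto
      have "mult A (gen A a) (blade A (insert b I)) \<in> {blade A (insert b J), - blade A (insert b J)}"
        using aI cl(2) blade_closed[OF J(1)] by (auto simp: * bJ mult_neg_right)
      moreover have "insert b J \<subseteq> {1..p+q}" "insert b J \<subseteq> insert a (insert b I)"
        using J b by auto
      ultimately show ?thesis by blast
    qed
  qed
qed

lemma blade_blade:
  assumes I: "I \<subseteq> {1..p+q}" and J: "J \<subseteq> {1..p+q}"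
  shows "\<exists>K. K \<subseteq> {1..p+q} \<and> mult A (blade A I) (blade A J) \<in> {blade A K, - blade A K}"
proof -
  have "finite I" using I finite_subset by blast
  then show ?thesis using I
  proof (induction I rule: finite_linorder_min_induct)
    case empty
    then show ?case
      using J by (intro exI[of _ J]) (simp add: blade_empty ident_left blade_closed)
  next
    case (insert b I)
    have b: "b \<in> {1..p+q}" and I: "I \<subseteq> {1..p+q}" using insert.prems by auto
    note cl = gen_closed[OF b] blade_closed[OF I] blade_closed[OF J]
    obtain K where K: "K \<subseteq> {1..p+q}"
      and IJ: "mult A (blade A I) (blade A J) \<in> {blade A K, - blade A K}"
      using insert.IH[OF I] by blast
    obtain L where L: "L \<subseteq> {1..p+q}"
      and bK: "mult A (gen A b) (blade A K) \<in> {blade A L, - blade A L}"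
      using gen_blade[OF K b] by blast
    have bI: "blade A (insert b I) = mult A (gen A b) (blade A I)"
      using insert.hyps by (intro blade_insert) auto
    have "mult A (blade A (insert b I)) (blade A J) = mult A (gen A b) (mult A (blade A I) (blade A J))"
      unfolding bI using cl by (intro mult_assoc)
    then have "mult A (blade A (insert b I)) (blade A J) \<in> {blade A L, - blade A L}"
      using IJ bK cl(1) blade_closed[OF K] by (auto simp: mult_neg_right)
    then show ?case using L by blast
  qed
qed

end

text \<open>
  The real span of the blades of a complex Clifford algebra is the real Clifford algebra of the
  same signature.
\<close>

lemma clifford_algebra_real_form:
  assumes "clifford_algebra C p q"
  shows "clifford_algebra (real_form (p+q) C) p q"
proof -
  interpret C: clifford_algebra C p q by fact
  let ?R = "real_form (p+q) C"
  let ?B = "blade C ` Pow {1..p+q}"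
  have sel: "smul ?R = (\<lambda>r. smul C (complex_of_real r))" "mult ?R = mult C"
    "ident ?R = ident C" "gen ?R = gen C"
    by (simp_all add: real_form_def restrict_real_def)
  have blade: "blade ?R = blade C"
    by (simp add: fun_eq_iff blade_def sel)
  interpret R: vector_space "smul ?R"
    unfolding sel by unfold_locales
      (simp_all add: C.scale_right_distrib C.scale_left_distrib)
  have carr: "carrier ?R = R.span ?B"
    unfolding sel by (simp add: real_form_def restrict_real_def)
  have sub: "R.subspace (carrier C)"
    unfolding R.subspace_def by (simp add: sel C.carrier_zero C.carrier_add C.carrier_smul)
  have le: "carrier ?R \<subseteq> carrier C"
    unfolding carr using C.blade_closed by (intro R.span_minimal sub) auto
  have B: "blade C I \<in> carrier ?R" if "I \<subseteq> {1..p+q}" for I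
    unfolding carr using that by (intro R.span_base) auto
  have RS: "R.subspace (carrier ?R)"
    by (simp add: carr)
  have 1: "mult C x y \<in> carrier ?R" if x: "x \<in> ?B" and y: "y \<in> R.span ?B" for x y
  proof -
    have xC: "x \<in> carrier C" using x C.blade_closed by auto
    have "R.subspace {y \<in> carrier C. mult C x y \<in> carrier ?R}"
      using sub RS xC unfolding R.subspace_def
      by (simp add: sel C.mult_zero_right C.mult_add_right C.mult_smul_right)
    moreover have "?B \<subseteq> {y \<in> carrier C. mult C x y \<in> carrier ?R}"
    proof
      fix z assume "z \<in> ?B"
      then obtain J where J: "z = blade C J" "J \<subseteq> {1..p+q}" by auto
      obtain I where I: "x = blade C I" "I \<subseteq> {1..p+q}" using x by auto
      obtain K where K: "K \<subseteq> {1..p+q}" "mult C x z \<in> {blade C K, - blade C K}"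
        using C.blade_blade[OF I(2) J(2)] I J by auto
      have "mult C x z \<in> carrier ?R"
        using K(2) B[OF K(1)] R.subspace_neg[OF RS] by auto
      then show "z \<in> {y \<in> carrier C. mult C x y \<in> carrier ?R}"
        using J C.blade_closed by simp
    qed
    ultimately show ?thesis
      using R.span_minimal y by blast
  qed
  have closed: "mult C x y \<in> carrier ?R" if x: "x \<in> carrier ?R" and y: "y \<in> carrier ?R" for x y
  proof -
    have yC: "y \<in> carrier C" using y le by blast
    have "R.subspace {x \<in> carrier C. mult C x y \<in> carrier ?R}"
      using sub RS yC unfolding R.subspace_def
      by (simp add: sel C.mult_zero_left C.mult_add_left C.mult_smul_left)
    moreover have "?B \<subseteq> {x \<in> carrier C. mult C x y \<in> carrier ?R}"
      using 1 y C.blade_closed unfolding carr by auto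
    ultimately show ?thesis
      using R.span_minimal x unfolding carr by blast
  qed
  have ind: "R.independent ?B"
  proof
    assume "R.dependent ?B"
    then obtain t u v where t: "finite t" "t \<subseteq> ?B" and s: "(\<Sum>v\<in>t. smul ?R (u v) v) = 0"
      and v: "v \<in> t" "u v \<noteq> 0"
      unfolding R.dependent_explicit by (elim exE conjE bexE)
    have "(\<Sum>v\<in>t. smul C (complex_of_real (u v)) v) = 0"
      using s unfolding sel .
    from C.independentD[OF C.blade_independent t this v(1)] show False
      using v(2) by simp
  qed
  show ?thesis
  proof unfold_locales
    show "mult ?R x y \<in> carrier ?R" if "x \<in> carrier ?R" "y \<in> carrier ?R" for x y
      using closed that by (simp add: sel)
    show "ident ?R \<in> carrier ?R"
      using B[of "{}"] by (simp add: sel blade_empty)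
    show "gen ?R a \<in> carrier ?R" if "a \<in> {1..p+q}" for a
    proof -
      have "blade C {a} = gen C a"
        using blade_insert[of "{}" a C] that by (simp add: blade_empty C.ident_right C.gen_closed)
      then show ?thesis using B[of "{a}"] that by (simp add: sel)
    qed
    show "mult ?R (gen ?R a) (gen ?R b) + mult ?R (gen ?R b) (gen ?R a) =
        smul ?R (2 * eta p a b) (ident ?R)" if "a \<in> {1..p+q}" "b \<in> {1..p+q}" for a b
    proof -
      have "complex_of_real (2 * eta p a b) = 2 * eta p a b"
        by (simp add: eta_def)
      then show ?thesis using C.gen_anticomm[OF that] by (simp only: sel)
    qed
    show "inj_on (blade ?R) (Pow {1..p+q})"
      unfolding blade by (rule C.blade_inj)
    show "R.independent (blade ?R ` Pow {1..p+q})"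
      unfolding blade by (rule ind)
    show "carrier ?R = R.span (blade ?R ` Pow {1..p+q})"
      unfolding blade by (rule carr)
  qed (simp_all add: sel subsetD[OF le] C.mult_assoc C.mult_add_left C.mult_add_right
        C.mult_smul_left C.mult_smul_right C.ident_left C.ident_right)
qed

text \<open>
  Clifford algebras of every signature exist: on functions from index sets to scalars, the blades
  multiply by symmetric difference of the index sets, up to a sign.
\<close>

context
  fixes p q :: nat
begin

private definition sgm :: "nat \<Rightarrow> nat \<Rightarrow> 'f::field_char_0" where
  "sgm a b = (if b < a then -1 else if a = b then eta p a a else 1)"

private definition sg :: "nat set \<Rightarrow> nat set \<Rightarrow> 'f::field_char_0" where
  "sg I J = (\<Prod>a\<in>I. \<Prod>b\<in>J. sgm a b)"

private definition sd :: "nat set \<Rightarrow> nat set \<Rightarrow> nat set" where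
  "sd I J = (I - J) \<union> (J - I)"

private definition dl :: "nat set \<Rightarrow> nat set \<Rightarrow> 'f::field_char_0" where
  "dl I = (\<lambda>K. if K = I then 1 else 0)"

private definition mdl :: "('f::field_char_0, nat set \<Rightarrow> 'f) gen_algebra" where
  "mdl = \<lparr>carrier = {f. \<forall>I. \<not> I \<subseteq> {1..p+q} \<longrightarrow> f I = 0},
    smul = (\<lambda>c f I. c * f I),
    mult = (\<lambda>f g K. if K \<subseteq> {1..p+q} then
       (\<Sum>I\<in>Pow {1..p+q}. sg I (sd I K) * f I * g (sd I K)) else 0),
    ident = dl {}, gen = (\<lambda>a. dl {a})\<rparr>"

private lemma sgm_sq: "sgm a b * sgm a b = 1"
  by (simp add: sgm_def eta_def)

private lemma prod_sd:
  fixes f :: "nat \<Rightarrow> 'f::field_char_0"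
  assumes "finite I" "finite J" "\<And>a. f a * f a = 1"
  shows "prod f (sd I J) = prod f I * prod f J"
proof -
  have 1: "prod f I = prod f (I - J) * prod f (I \<inter> J)"
    using assms by (subst prod.union_disjoint[symmetric]) (auto intro: prod.cong)
  have 2: "prod f J = prod f (J - I) * prod f (I \<inter> J)"
    using assms by (subst prod.union_disjoint[symmetric]) (auto intro: prod.cong)
  have 3: "prod f (I \<inter> J) * prod f (I \<inter> J) = 1"
    using assms by (simp add: prod.distrib[symmetric])
  have 4: "prod f (sd I J) = prod f (I - J) * prod f (J - I)"
    unfolding sd_def using assms by (intro prod.union_disjoint) auto
  have "prod f I * prod f J = prod f (I - J) * prod f (J - I) * (prod f (I \<inter> J) * prod f (I \<inter> J))"
    unfolding 1 2 by (simp only: mult_ac)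
  then show ?thesis using 3 4 by simp
qed

private lemma sg_sd_right:
  assumes "finite J" "finite K"
  shows "sg I (sd J K) = sg I J * sg I K"
  unfolding sg_def prod.distrib[symmetric] using assms
  by (intro prod.cong prod_sd sgm_sq) auto

private lemma sg_sd_left:
  assumes "finite I" "finite J"
  shows "sg (sd I J) K = sg I K * sg J K"
  unfolding sg_def using assms
  by (intro prod_sd) (simp_all add: prod.distrib[symmetric] sgm_sq)

private lemma sg_empty: "sg {} J = 1" "sg I {} = 1"
  by (simp_all add: sg_def)

private lemma sd_simps: "sd I {} = I" "sd {} I = I" "sd I I = {}" "sd I (sd I J) = J"
  "sd (sd I J) K = sd I (sd J K)"
  by (auto simp: sd_def)

private lemma sd_sub: "I \<subseteq> N \<Longrightarrow> J \<subseteq> N \<Longrightarrow> sd I J \<subseteq> N"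
  by (auto simp: sd_def)

private lemma mdl_sel:
  "f \<in> carrier mdl \<longleftrightarrow> (\<forall>I. \<not> I \<subseteq> {1..p+q} \<longrightarrow> f I = 0)"
  "smul mdl c f = (\<lambda>I. c * f I)"
  "ident mdl = dl {}" "gen mdl a = dl {a}"
  "mult mdl f g = (\<lambda>K. if K \<subseteq> {1..p+q} then
       (\<Sum>I\<in>Pow {1..p+q}. sg I (sd I K) * f I * g (sd I K)) else 0)"
  by (simp_all add: mdl_def)

private lemma mdl_assoc: "mult mdl (mult mdl f g) h = mult mdl f (mult mdl g h)"
proof
  fix L
  let ?N = "{1..p+q}"
  show "mult mdl (mult mdl f g) h L = mult mdl f (mult mdl g h) L"
  proof (cases "L \<subseteq> ?N")
    case L: True
    have "mult mdl (mult mdl f g) h L =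
      (\<Sum>J\<in>Pow ?N. \<Sum>I\<in>Pow ?N. sg J (sd J L) * (sg I (sd I J) * f I * g (sd I J)) * h (sd J L))"
      using L by (simp add: mdl_sel sum_distrib_left sum_distrib_right)
    also have "\<dots> =
      (\<Sum>I\<in>Pow ?N. \<Sum>J\<in>Pow ?N. sg J (sd J L) * (sg I (sd I J) * f I * g (sd I J)) * h (sd J L))"
      by (rule sum.swap)
    also have "\<dots> =
      (\<Sum>I\<in>Pow ?N. \<Sum>J\<in>Pow ?N. sg I (sd I L) * f I * (sg J (sd J (sd I L)) * g J * h (sd J (sd I L))))"
    proof (rule sum.cong[OF refl])
      fix I assume I: "I \<in> Pow ?N"
      have "(\<Sum>J\<in>Pow ?N. sg J (sd J L) * (sg I (sd I J) * f I * g (sd I J)) * h (sd J L)) =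
        (\<Sum>J\<in>Pow ?N. sg (sd I J) (sd (sd I J) L) * (sg I J * f I * g J) * h (sd (sd I J) L))"
        using I by (intro sum.reindex_bij_witness[of _ "sd I" "sd I"]) (auto simp: sd_simps dest: sd_sub)
      also have "\<dots> = (\<Sum>J\<in>Pow ?N. sg I (sd I L) * f I *
          (sg J (sd J (sd I L)) * g J * h (sd J (sd I L))))"
      proof (rule sum.cong[OF refl])
        fix J assume J: "J \<in> Pow ?N"
        have fin: "finite I" "finite J" "finite L"
          using I J L finite_subset by blast+
        define K where "K = sd (sd I J) L"
        have K: "sd J (sd I L) = K" "sd I L = sd J K" "finite K"
          unfolding K_def using fin by (auto simp: sd_def)
        show "sg (sd I J) (sd (sd I J) L) * (sg I J * f I * g J) * h (sd (sd I J) L) =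
          sg I (sd I L) * f I * (sg J (sd J (sd I L)) * g J * h (sd J (sd I L)))"
          unfolding K_def[symmetric] K(1) unfolding K(2)
          using fin K(3) by (simp add: sg_sd_left sg_sd_right mult_ac)
      qed
      finally show "(\<Sum>J\<in>Pow ?N. sg J (sd J L) * (sg I (sd I J) * f I * g (sd I J)) * h (sd J L)) =
        (\<Sum>J\<in>Pow ?N. sg I (sd I L) * f I * (sg J (sd J (sd I L)) * g J * h (sd J (sd I L))))" .
    qed
    also have "\<dots> = (\<Sum>I\<in>Pow ?N. sg I (sd I L) * f I * mult mdl g h (sd I L))"
    proof (rule sum.cong[OF refl])
      fix I assume "I \<in> Pow ?N"
      then have "sd I L \<subseteq> ?N" using L sd_sub by blast
      then show "(\<Sum>J\<in>Pow ?N. sg I (sd I L) * f I *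
          (sg J (sd J (sd I L)) * g J * h (sd J (sd I L)))) =
          sg I (sd I L) * f I * mult mdl g h (sd I L)"
        by (simp add: mdl_sel(5) sum_distrib_left)
    qed
    also have "\<dots> = mult mdl f (mult mdl g h) L"
      using L by (subst mdl_sel(5)) simp
    finally show ?thesis .
  qed (simp add: mdl_sel)
qed

private lemma mdl_dl:
  assumes I: "I \<subseteq> {1..p+q}" and J: "J \<subseteq> {1..p+q}"
  shows "mult mdl (dl I) (dl J) = smul mdl (sg I J) (dl (sd I J))"
proof
  fix K
  show "mult mdl (dl I) (dl J) K = smul mdl (sg I J) (dl (sd I J)) K"
  proof (cases "K \<subseteq> {1..p+q}")
    case True
    have "mult mdl (dl I) (dl J) K = (\<Sum>L\<in>Pow {1..p+q}. sg L (sd L K) * dl I L * dl J (sd L K))"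
      using True by (simp add: mdl_sel(5))
    also have "\<dots> = (\<Sum>L\<in>Pow {1..p+q}. if L = I then sg I (sd I K) * dl J (sd I K) else 0)"
      by (intro sum.cong) (auto simp: dl_def)
    also have "\<dots> = sg I (sd I K) * dl J (sd I K)"
      using I by (simp add: sum.delta)
    also have "\<dots> = smul mdl (sg I J) (dl (sd I J)) K"
    proof -
      have "sd I K = J \<longleftrightarrow> K = sd I J" by (auto simp: sd_simps)
      then show ?thesis by (auto simp: mdl_sel(2) dl_def sd_simps)
    qed
    finally show ?thesis .
  next
    case False
    then have "K \<noteq> sd I J" using sd_sub[OF I J] by blast
    then show ?thesis using False by (simp add: mdl_sel dl_def)
  qed
qed

private lemma mdl_blade:
  assumes "I \<subseteq> {1..p+q}"
  shows "blade (mdl :: ('f::field_char_0, nat set \<Rightarrow> 'f) gen_algebra) I = dl I"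
proof -
  have "finite I" using assms finite_subset by blast
  then show ?thesis using assms
  proof (induction I rule: finite_linorder_min_induct)
    case empty
    then show ?case by (simp add: blade_empty mdl_sel)
  next
    case (insert b I)
    have "sg {b} I = (1 :: 'f)"
      using insert.hyps by (auto simp: sg_def sgm_def intro!: prod.neutral)
    moreover have "sd {b} I = insert b I"
      using insert.hyps by (auto simp: sd_def)
    moreover have "blade mdl (insert b I) = mult mdl (dl {b}) (dl I :: nat set \<Rightarrow> 'f)"
      using blade_insert[of I b "mdl :: ('f, nat set \<Rightarrow> 'f) gen_algebra"] insert by (simp add: mdl_sel(4))
    moreover have "mult mdl (dl {b}) (dl I :: nat set \<Rightarrow> 'f) = smul mdl (sg {b} I) (dl (sd {b} I))"
      using insert.prems by (intro mdl_dl) auto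
    ultimately show ?case by (simp add: mdl_sel(2))
  qed
qed

private lemma sum_fun_apply:
  "finite t \<Longrightarrow> (\<Sum>v\<in>t. F v :: nat set \<Rightarrow> 'f::field_char_0) I = (\<Sum>v\<in>t. F v I)"
  by (induction t rule: finite_induct) (auto simp: zero_fun_def plus_fun_def)

lemma clifford_algebra_exists:
  "\<exists>A :: ('f::field_char_0, nat set \<Rightarrow> 'f) gen_algebra. clifford_algebra A p q"
proof
  let ?N = "{1..p+q}"
  let ?A = "mdl :: ('f, nat set \<Rightarrow> 'f) gen_algebra"
  interpret M: vector_space "smul ?A"
    by unfold_locales (simp_all add: mdl_sel(2) plus_fun_def distrib_left distrib_right mult.assoc)
  have bl: "blade ?A ` Pow ?N = dl ` Pow ?N"
    by (intro image_cong) (auto simp: mdl_blade)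
  have dl_eq: "dl I = (dl J :: nat set \<Rightarrow> 'f) \<longleftrightarrow> I = J" for I J
    unfolding dl_def fun_eq_iff by (metis zero_neq_one)
  have dl_carrier: "dl I \<in> carrier ?A" if "I \<subseteq> ?N" for I
    using that by (auto simp: mdl_sel(1) dl_def)
  have ind: "M.independent (dl ` Pow ?N)"
  proof
    assume "M.dependent (dl ` Pow ?N)"
    then obtain t u v where t: "finite t" "t \<subseteq> dl ` Pow ?N" and s: "(\<Sum>v\<in>t. smul ?A (u v) v) = 0"
      and v: "v \<in> t" "u v \<noteq> 0"
      unfolding M.dependent_explicit by (elim exE conjE bexE)
    obtain I where I: "v = dl I" using t v by blast
    have "0 = (\<Sum>w\<in>t. smul ?A (u w) w) I"
      using s by (simp add: zero_fun_def)
    also have "\<dots> = (\<Sum>w\<in>t. u w * w I)"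
      using t by (simp add: sum_fun_apply mdl_sel)
    also have "\<dots> = (\<Sum>w\<in>t. if w = v then u v else 0)"
    proof (rule sum.cong[OF refl])
      fix w assume "w \<in> t"
      then obtain J where J: "w = dl J" using t by blast
      have "w = v \<longleftrightarrow> J = I" unfolding I J by (rule dl_eq)
      then show "u w * w I = (if w = v then u v else 0)"
        by (auto simp: J dl_def)
    qed
    also have "\<dots> = u v" using t v by simp
    finally show False using v by simp
  qed
  have span: "carrier ?A = M.span (dl ` Pow ?N)"
  proof
    show "M.span (dl ` Pow ?N) \<subseteq> carrier ?A"
      using dl_carrier
      by (intro M.span_minimal) (auto simp: M.subspace_def mdl_sel(1,2) plus_fun_def zero_fun_def)
    show "carrier ?A \<subseteq> M.span (dl ` Pow ?N)"
    proof
      fix f assume f: "f \<in> carrier ?A"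
      have "f = (\<Sum>I\<in>Pow ?N. smul ?A (f I) (dl I))"
      proof
        fix K
        have "(\<Sum>I\<in>Pow ?N. smul ?A (f I) (dl I)) K = (\<Sum>I\<in>Pow ?N. f I * dl I K)"
          by (simp add: sum_fun_apply mdl_sel(2))
        also have "\<dots> = (\<Sum>I\<in>Pow ?N. if K = I then f I else 0)"
          by (intro sum.cong) (auto simp: dl_def)
        also have "\<dots> = f K"
          using f by (cases "K \<subseteq> ?N") (simp_all add: mdl_sel(1) sum.delta)
        finally show "f K = (\<Sum>I\<in>Pow ?N. smul ?A (f I) (dl I)) K" by simp
      qed
      also have "\<dots> \<in> M.span (dl ` Pow ?N)"
        by (intro M.span_sum M.span_scale M.span_base) auto
      finally show "f \<in> M.span (dl ` Pow ?N)" .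
    qed
  qed
  show "clifford_algebra ?A p q"
  proof unfold_locales
    show "mult ?A x y \<in> carrier ?A" for x y
      by (simp add: mdl_sel)
    show "mult ?A (mult ?A x y) z = mult ?A x (mult ?A y z)" for x y z
      by (rule mdl_assoc)
    show "mult ?A (x + y) z = mult ?A x z + mult ?A y z" for x y z
      by (simp add: fun_eq_iff mdl_sel(5) plus_fun_def distrib_left distrib_right sum.distrib)
    show "mult ?A x (y + z) = mult ?A x y + mult ?A x z" for x y z
      by (simp add: fun_eq_iff mdl_sel(5) plus_fun_def distrib_left distrib_right sum.distrib)
    show "mult ?A (smul ?A c x) y = smul ?A c (mult ?A x y)" for c x y
      by (simp add: fun_eq_iff mdl_sel(2,5) sum_distrib_left mult_ac)
    show "mult ?A x (smul ?A c y) = smul ?A c (mult ?A x y)" for c x y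
      by (simp add: fun_eq_iff mdl_sel(2,5) sum_distrib_left mult_ac)
    show "ident ?A \<in> carrier ?A"
      using dl_carrier[of "{}"] by (simp add: mdl_sel(3))
    show "gen ?A a \<in> carrier ?A" if "a \<in> ?N" for a
      using dl_carrier[of "{a}"] that by (simp add: mdl_sel(4))
    show "mult ?A (ident ?A) x = x" if "x \<in> carrier ?A" for x
    proof
      fix K
      have "(\<Sum>I\<in>Pow ?N. sg I (sd I K) * dl {} I * x (sd I K)) =
          (\<Sum>I\<in>Pow ?N. if I = {} then x K else 0)"
        by (intro sum.cong) (auto simp: dl_def sg_empty sd_simps)
      also have "\<dots> = x K"
        by (simp add: sum.delta)
      finally show "mult ?A (ident ?A) x K = x K"
        using that by (cases "K \<subseteq> ?N") (simp_all add: mdl_sel(1,3,5))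
    qed
    show "mult ?A x (ident ?A) = x" if "x \<in> carrier ?A" for x
    proof
      fix K
      have sdK: "sd I K = {} \<longleftrightarrow> K = I" for I by (auto simp: sd_def)
      have "(\<Sum>I\<in>Pow ?N. sg I (sd I K) * x I * dl {} (sd I K)) =
          (\<Sum>I\<in>Pow ?N. if K = I then x I else 0)"
        by (intro sum.cong) (auto simp: dl_def sdK sg_empty sd_simps)
      also have "\<dots> = x K" if "K \<subseteq> ?N"
        using that by (simp add: sum.delta)
      finally show "mult ?A x (ident ?A) K = x K"
        using that by (cases "K \<subseteq> ?N") (simp_all add: mdl_sel(1,3,5))
    qed
    show "mult ?A (gen ?A a) (gen ?A b) + mult ?A (gen ?A b) (gen ?A a) =
        smul ?A (2 * eta p a b) (ident ?A)" if "a \<in> ?N" "b \<in> ?N" for a b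
    proof -
      have "mult ?A (gen ?A a) (gen ?A b) = smul ?A (sgm a b) (dl (sd {a} {b}))"
           "mult ?A (gen ?A b) (gen ?A a) = smul ?A (sgm b a) (dl (sd {a} {b}))"
        using that mdl_dl[of "{a}" "{b}"] mdl_dl[of "{b}" "{a}"]
        by (simp_all add: mdl_sel(4) sg_def sd_def Un_commute)
      then have "mult ?A (gen ?A a) (gen ?A b) + mult ?A (gen ?A b) (gen ?A a) =
          smul ?A (sgm a b + sgm b a) (dl (sd {a} {b}))"
        by (simp add: M.scale_left_distrib)
      moreover have "sgm a b + sgm b a = (2 * eta p a b :: 'f)"
        by (auto simp: sgm_def eta_def)
      moreover have "eta p a b = (0 :: 'f) \<or> sd {a} {b} = {}"
        by (auto simp: eta_def sd_def)
      ultimately show ?thesis by (auto simp: mdl_sel(2,3))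
    qed
    show "inj_on (blade ?A) (Pow ?N)"
      by (intro inj_onI) (simp add: mdl_blade dl_eq)
    show "M.independent (blade ?A ` Pow ?N)"
      unfolding bl by (rule ind)
    show "carrier ?A = M.span (blade ?A ` Pow ?N)"
      unfolding bl by (rule span)
  qed
qed

end

end

theory Submission
  imports Defs
begin

text \<open>
  Multiplying a blade by a generator toggles one index, up to a sign. Hence the product of blades
  of ranks \<open>k\<close> and \<open>l\<close> is \<open>\<plusminus>\<close> a blade of rank congruent to \<open>k + l\<close> modulo 2, i.e. the Clifford
  algebra is \<open>\<int>/2\<close>-graded by the parity of the rank. All the subspaces in question are sums of
  parity components, with coefficients in \<open>\<real>\<close> or \<open>\<i>\<real>\<close> chosen compatibly with \<open>\<i>\<^sup>2 = -1\<close>.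
\<close>

section \<open>Parity of products of blades\<close>

context clifford_algebra
begin

text \<open>Sharpens \<open>gen_blade\<close>: an inclusion for the index set would not determine
  the parity of its size, so the exact set is needed. Induction peels off the least index
  \<open>b\<close>: for \<open>a < b\<close> the product is already ordered, for
  \<open>a = b\<close> the generator squares to a scalar, and for \<open>b < a\<close>
  anticommutation moves \<open>a\<close> past \<open>b\<close> into the tail. The sign is left open
  because subspaces absorb it.\<close>

lemma gen_blade_toggle:
  assumes I: "I \<subseteq> {1..p+q}" and a: "a \<in> {1..p+q}"
  defines "J \<equiv> if a \<in> I then I - {a} else insert a I"
  shows "mult A (gen A a) (blade A I) \<in> {blade A J, - blade A J}"
proof -
  have "finite I" using I finite_subset by blast
  then show ?thesis using I unfolding J_def
  proof (induction I rule: finite_linorder_min_induct)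
    case empty
    then show ?case using blade_insert[of "{}" a A] by simp
  next
    case (insert b I)
    have b: "b \<in> {1..p+q}" and I: "I \<subseteq> {1..p+q}" using insert.prems by auto
    have bnI: "b \<notin> I" using insert.hyps by blast
    note cl = gen_closed[OF a] gen_closed[OF b] blade_closed[OF I]
    have bI: "blade A (insert b I) = mult A (gen A b) (blade A I)"
      using insert.hyps by (intro blade_insert) auto
    consider "a < b" | "a = b" | "b < a" by linarith
    then show ?case
    proof cases
      case 1
      then have "mult A (gen A a) (blade A (insert b I)) = blade A (insert a (insert b I))"
        using insert.hyps by (intro blade_insert[symmetric]) auto
      moreover have "a \<notin> insert b I" using 1 insert.hyps by auto
      ultimately show ?thesis by simp
    next
      case 2
      have "mult A (gen A a) (blade A (insert b I)) = mult A (mult A (gen A a) (gen A a)) (blade A I)"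
        unfolding bI unfolding 2[symmetric] using cl by (intro mult_assoc[symmetric])
      \<comment> \<open>The scalar is 1 or -1, so the index \<open>a\<close> cancels and only the
        tail \<open>I\<close> remains.\<close>
      also have "\<dots> = smul A (eta p a a) (blade A I)"
        using cl by (simp add: gen_square[OF a] mult_smul_left ident_closed ident_left)
      finally show ?thesis using 2 bnI by (simp add: eta_def)
    next
      case 3
      \<comment> \<open>Toggling \<open>a\<close> in the tail keeps all its indices above
        \<open>b\<close>, so \<open>b\<close> can be put back in front as an ordered blade.\<close>
      define K where "K = (if a \<in> I then I - {a} else insert a I)"
      have K: "K \<subseteq> {1..p+q}" "\<forall>i\<in>K. b < i"
        using I a 3 insert.hyps by (auto simp: K_def)
      have aI: "mult A (gen A a) (blade A I) \<in> {blade A K, - blade A K}"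
        using insert.IH[OF I] unfolding K_def .
      have "mult A (gen A a) (blade A (insert b I)) = mult A (mult A (gen A a) (gen A b)) (blade A I)"
        unfolding bI using cl by (intro mult_assoc[symmetric])
      also have "\<dots> = - mult A (gen A b) (mult A (gen A a) (blade A I))"
        using cl gen_swap[OF a b] 3 by (simp add: mult_neg_left mult_closed mult_assoc)
      finally have "mult A (gen A a) (blade A (insert b I)) =
          - mult A (gen A b) (mult A (gen A a) (blade A I))" .
      moreover have "mult A (gen A b) (blade A K) = blade A (insert b K)"
        using K finite_subset[OF K(1)] by (intro blade_insert[symmetric]) auto
      ultimately have "mult A (gen A a) (blade A (insert b I)) \<in>
          {blade A (insert b K), - blade A (insert b K)}"
        using aI cl(2) blade_closed[OF K(1)] by (auto simp: mult_neg_right)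
      moreover have "insert b K = (if a \<in> insert b I then insert b I - {a} else insert a (insert b I))"
        using 3 by (auto simp: K_def)
      ultimately show ?thesis by simp
    qed
  qed
qed

text \<open>The generators of \<open>blade A I\<close> act on \<open>blade A J\<close> one after
  another, and each toggles one index. Equality of Booleans expresses addition of parities modulo
  2.\<close>

lemma blade_blade_parity:
  assumes I: "I \<subseteq> {1..p+q}" and J: "J \<subseteq> {1..p+q}"
  shows "\<exists>K. K \<subseteq> {1..p+q} \<and> even (card K) = (even (card I) = even (card J)) \<and>
           mult A (blade A I) (blade A J) \<in> {blade A K, - blade A K}"
proof -
  have "finite I" using I finite_subset by blast
  then show ?thesis using I
  proof (induction I rule: finite_linorder_min_induct)
    case empty
    then show ?case
      using J by (intro exI[of _ J]) (simp add: blade_empty ident_left blade_closed)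
  next
    case (insert b I)
    have b: "b \<in> {1..p+q}" and I: "I \<subseteq> {1..p+q}" using insert.prems by auto
    have bnI: "b \<notin> I" using insert.hyps by blast
    note cl = gen_closed[OF b] blade_closed[OF I] blade_closed[OF J]
    obtain K where K: "K \<subseteq> {1..p+q}" "even (card K) = (even (card I) = even (card J))"
      and IJ: "mult A (blade A I) (blade A J) \<in> {blade A K, - blade A K}"
      using insert.IH[OF I] by blast
    define L where "L = (if b \<in> K then K - {b} else insert b K)"
    have fK: "finite K" using K(1) finite_subset by blast
    have L: "L \<subseteq> {1..p+q}" using K(1) b by (auto simp: L_def)
    \<comment> \<open>A toggle changes the number of indices by exactly one, up or down.\<close>
    have cL: "even (card L) \<noteq> even (card K)"
    proof (cases "b \<in> K")
      case True
      then have "card K = Suc (card L)"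
        using card_Suc_Diff1[OF fK] unfolding L_def by metis
      then show ?thesis by simp
    qed (use fK in \<open>simp add: L_def\<close>)
    have bK: "mult A (gen A b) (blade A K) \<in> {blade A L, - blade A L}"
      using gen_blade_toggle[OF K(1) b] unfolding L_def .
    have bI: "blade A (insert b I) = mult A (gen A b) (blade A I)"
      using insert.hyps by (intro blade_insert) auto
    have "mult A (blade A (insert b I)) (blade A J) = mult A (gen A b) (mult A (blade A I) (blade A J))"
      unfolding bI using cl by (intro mult_assoc)
    then have "mult A (blade A (insert b I)) (blade A J) \<in> {blade A L, - blade A L}"
      using IJ bK cl(1) blade_closed[OF K(1)] by (auto simp: mult_neg_right)
    \<comment> \<open>Passing from \<open>K\<close> to \<open>L\<close> and from \<open>I\<close> to
      \<open>insert b I\<close> flips both parities, so the relation persists.\<close>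
    moreover have "even (card L) = (even (card (insert b I)) = even (card J))"
      using cL K(2) bnI insert.hyps(1) by auto
    ultimately show ?case using L by blast
  qed
qed

text \<open>Bilinearity reduces closure to spanning elements: first the right factor is extended to
  \<open>span T\<close> with \<open>s\<close> fixed, then the left factor to \<open>span S\<close>
  with \<open>y\<close> fixed.\<close>

lemma mult_span_closed:
  assumes S: "S \<subseteq> carrier A" and T: "T \<subseteq> carrier A" and U: "subspace U"
    and ST: "\<And>s t. s \<in> S \<Longrightarrow> t \<in> T \<Longrightarrow> mult A s t \<in> U"
    and x: "x \<in> span S" and y: "y \<in> span T"
  shows "mult A x y \<in> U"
proof -
  have yc: "y \<in> carrier A"
    using span_minimal[OF T carrier_subspace] y by blast
  \<comment> \<open>The set is cut down to the carrier because the laws of \<open>mult A\<close> are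
    available only there.\<close>
  have "subspace {z \<in> carrier A. mult A s z \<in> U}" if "s \<in> S" for s
    using U carrier_subspace S that unfolding subspace_def
    by (auto simp: mult_zero_right mult_add_right mult_smul_right subset_iff)
  then have *: "mult A s y \<in> U" if "s \<in> S" for s
    using span_minimal[of T "{z \<in> carrier A. mult A s z \<in> U}"] T ST that y by blast
  have "subspace {z \<in> carrier A. mult A z y \<in> U}"
    using U carrier_subspace yc unfolding subspace_def
    by (auto simp: mult_zero_left mult_add_left mult_smul_left)
  then show ?thesis
    using span_minimal[of S "{z \<in> carrier A. mult A z y \<in> U}"] S * x by blast
qed

text \<open>The Booleans \<open>b\<close> and \<open>c\<close> encode the parity classes, so the
  four even/odd cases share one proof, from \<open>blade_blade_parity\<close> by bilinear
  extension.\<close>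

lemma mult_graded_sum_parity:
  assumes "x \<in> graded_sum (p+q) A {k. even k = b}" "y \<in> graded_sum (p+q) A {k. even k = c}"
  shows "mult A x y \<in> graded_sum (p+q) A {k. even k = (b = c)}"
proof -
  let ?B = "\<lambda>b. blade A ` {I. I \<subseteq> {1..p+q} \<and> card I \<in> {k. even k = b}}"
  have sub: "?B b \<subseteq> carrier A" for b using blade_closed by auto
  have "mult A s t \<in> span (?B (b = c))" if s: "s \<in> ?B b" and t: "t \<in> ?B c" for s t
  proof -
    obtain I where I: "s = blade A I" "I \<subseteq> {1..p+q}" "even (card I) = b" using s by auto
    obtain J where J: "t = blade A J" "J \<subseteq> {1..p+q}" "even (card J) = c" using t by auto
    obtain K where K: "K \<subseteq> {1..p+q}" "even (card K) = (b = c)"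
      "mult A s t \<in> {blade A K, - blade A K}"
      using blade_blade_parity[OF I(2) J(2)] I J by auto
    have "blade A K \<in> span (?B (b = c))"
      using K by (intro span_base) auto
    then show ?thesis using K(3) span_neg by auto
  qed
  from mult_span_closed[OF sub sub subspace_span this] show ?thesis
    using assms unfolding graded_sum_eq by blast
qed

section \<open>Sums of rank subspaces and residues modulo 4\<close>

lemma subspace_graded_sum: "subspace (graded_sum (p+q) A J)"
  by (simp add: graded_sum_eq)

lemma graded_sum_subset_carrier: "graded_sum (p+q) A J \<subseteq> carrier A"
  unfolding graded_sum_eq blade_span by (intro span_mono) auto

text \<open>The span of a union is the sum of the spans. This reduces identities between sums of
  \<open>quat\<close> spaces to identities between sets of residues modulo 4.\<close>

lemma graded_sum_Un:
  "graded_sum (p+q) A J + graded_sum (p+q) A K = graded_sum (p+q) A (J \<union> K)"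
proof -
  have "blade A ` {I. I \<subseteq> {1..p+q} \<and> card I \<in> J \<union> K} =
      blade A ` {I. I \<subseteq> {1..p+q} \<and> card I \<in> J} \<union> blade A ` {I. I \<subseteq> {1..p+q} \<and> card I \<in> K}"
    by auto
  then show ?thesis
    unfolding graded_sum_eq by (auto simp: span_Un set_plus_def)
qed

lemma quat_even: "quat (p+q) A 0 + quat (p+q) A 2 = even_part (p+q) A"
proof -
  have "{j::nat. j mod 4 = 0} \<union> {j. j mod 4 = 2} = {k. even k}"
    by (auto; presburger)
  then show ?thesis
    unfolding quat_def even_part_def graded_sum_Un by simp
qed

lemma quat_odd: "quat (p+q) A 1 + quat (p+q) A 3 = odd_part (p+q) A"
proof -
  have "{j::nat. j mod 4 = 1} \<union> {j. j mod 4 = 3} = {k. odd k}"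
    by (auto; presburger)
  then show ?thesis
    unfolding quat_def odd_part_def graded_sum_Un by simp
qed

lemma quat_all:
  "quat (p+q) A 0 + quat (p+q) A 1 + quat (p+q) A 2 + quat (p+q) A 3 = carrier A"
proof -
  have "{j::nat. j mod 4 = 0} \<union> {j. j mod 4 = 1} \<union> {j. j mod 4 = 2} \<union> {j. j mod 4 = 3} = UNIV"
    by (auto; presburger)
  moreover have "graded_sum (p+q) A UNIV = carrier A"
    unfolding graded_sum_eq blade_span by (intro arg_cong[where f = span]) auto
  ultimately show ?thesis
    unfolding quat_def graded_sum_Un by simp
qed

text \<open>The instances are laid out to match the closure hypotheses of
  \<open>subalgebra_complexification\<close> below.\<close>

lemma mult_parts:
  "x \<in> even_part (p+q) A \<Longrightarrow> y \<in> even_part (p+q) A \<Longrightarrow> mult A x y \<in> even_part (p+q) A"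
  "x \<in> even_part (p+q) A \<Longrightarrow> y \<in> odd_part (p+q) A \<Longrightarrow> mult A x y \<in> odd_part (p+q) A"
  "x \<in> odd_part (p+q) A \<Longrightarrow> y \<in> even_part (p+q) A \<Longrightarrow> mult A x y \<in> odd_part (p+q) A"
  "x \<in> odd_part (p+q) A \<Longrightarrow> y \<in> odd_part (p+q) A \<Longrightarrow> mult A x y \<in> even_part (p+q) A"
  using mult_graded_sum_parity[of x True y True] mult_graded_sum_parity[of x True y False]
    mult_graded_sum_parity[of x False y True] mult_graded_sum_parity[of x False y False]
  by (simp_all add: even_part_def odd_part_def)

lemma subspace_parts: "subspace (even_part (p+q) A)" "subspace (odd_part (p+q) A)"
  by (simp_all add: even_part_def odd_part_def subspace_graded_sum)

lemma parts_subset_carrier: "even_part (p+q) A \<subseteq> carrier A" "odd_part (p+q) A \<subseteq> carrier A"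
  by (simp_all add: even_part_def odd_part_def graded_sum_subset_carrier)

lemma even_part_subalgebra: "is_subalgebra (even_part (p+q) A) A"
  by (simp add: is_subalgebra_def subspace_parts parts_subset_carrier mult_parts)

end

section \<open>A complex Clifford algebra and its real form\<close>

text \<open>With the real form registered as a second instance \<open>R\<close>, all results on
  \<open>clifford_algebra\<close> are available over both fields on the same elements.\<close>

locale complex_clifford_algebra = C: clifford_algebra C p q
  for C :: "(complex, 'b::ab_group_add) gen_algebra" and p q
begin

abbreviation R :: "(real, 'b) gen_algebra" where
  "R \<equiv> real_form (p+q) C"

sublocale R: clifford_algebra R p q
  by (rule clifford_algebra_real_form) unfold_locales

lemma real_form_sel:
  "smul R r = smul C (complex_of_real r)" "mult R = mult C" "ident R = ident C" "gen R = gen C"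
  by (simp_all add: real_form_def restrict_real_def)

lemma blade_real_form: "blade R = blade C"
  by (simp add: fun_eq_iff blade_def real_form_sel)

lemma smul_restrict_real: "smul (restrict_real C) = smul R"
  by (simp add: real_form_def)

lemma real_subspaceI: "C.subspace S \<Longrightarrow> R.subspace S"
  unfolding C.subspace_def R.subspace_def by (simp add: real_form_sel)

lemma real_form_subset: "carrier R \<subseteq> carrier C"
  unfolding R.blade_span blade_real_form
  using C.blade_closed by (intro R.span_minimal real_subspaceI C.carrier_subspace) auto

text \<open>Both algebras have the same real scalars and product; only the carrier grows.\<close>

lemma subalgebra_restrict_real: "is_subalgebra S R \<Longrightarrow> is_subalgebra S (restrict_real C)"
  unfolding is_subalgebra_def smul_restrict_real real_form_sel
  using real_form_subset by (auto simp: restrict_real_def)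

lemma smul_complex:
  "smul C c x = smul R (Re c) x + smul C \<i> (smul R (Im c) x)"
  unfolding real_form_sel C.scale_scale C.scale_left_distrib[symmetric]
  by (simp add: complex_eq[symmetric])

lemma smul_ii: "smul C \<i> (smul C \<i> x) = - x"
  by simp

lemma smul_real_i: "smul R r (smul C \<i> x) = smul C \<i> (smul R r x)"
  by (simp add: real_form_sel mult.commute)

section \<open>Real and imaginary parts: spaces of the form \<open>U + i_times C V\<close>\<close>

lemma i_timesI: "x \<in> S \<Longrightarrow> smul C \<i> x \<in> i_times C S"
  by (simp add: i_times_def)

lemma complexification_cases:
  assumes "z \<in> U + i_times C V"
  obtains x y where "x \<in> U" "y \<in> V" "z = x + smul C \<i> y"
  using assms by (auto simp: i_times_def elim!: set_plus_elim)

lemma complexificationI: "x \<in> U \<Longrightarrow> y \<in> V \<Longrightarrow> x + smul C \<i> y \<in> U + i_times C V"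
  by (intro set_plus_intro i_timesI)

text \<open>The right side contains \<open>S\<close> and is closed under complex scaling, so
  minimality of the complex span gives one inclusion. The other holds because a complex span is a
  real subspace closed under multiplication by \<i>.\<close>

lemma complex_span: "C.span S = R.span S + i_times C (R.span S)"
proof
  have sub: "R.span S \<subseteq> C.span S"
    using C.span_superset by (intro R.span_minimal real_subspaceI) auto
  show "R.span S + i_times C (R.span S) \<subseteq> C.span S"
    using sub by (auto elim!: complexification_cases intro!: C.span_add C.span_scale)
  show "C.span S \<subseteq> R.span S + i_times C (R.span S)"
  proof (rule C.span_minimal)
    show "S \<subseteq> R.span S + i_times C (R.span S)"
    proof
      fix x assume "x \<in> S"
      then show "x \<in> R.span S + i_times C (R.span S)"
        using complexificationI[of x "R.span S" 0 "R.span S"] by (simp add: R.span_base R.span_zero)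
    qed
    show "C.subspace (R.span S + i_times C (R.span S))"
      unfolding C.subspace_def
    proof (intro conjI ballI allI)
      show "0 \<in> R.span S + i_times C (R.span S)"
        using complexificationI[of 0 "R.span S" 0 "R.span S"] by (simp add: R.span_zero)
    next
      fix z w assume "z \<in> R.span S + i_times C (R.span S)" "w \<in> R.span S + i_times C (R.span S)"
      then obtain x y x' y' where xy: "x \<in> R.span S" "y \<in> R.span S" "z = x + smul C \<i> y"
        "x' \<in> R.span S" "y' \<in> R.span S" "w = x' + smul C \<i> y'"
        by (elim complexification_cases) blast
      have eq: "z + w = (x + x') + smul C \<i> (y + y')"
        by (simp add: xy C.scale_right_distrib algebra_simps)
      then show "z + w \<in> R.span S + i_times C (R.span S)"
        unfolding eq using xy by (intro complexificationI R.span_add)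
    next
      fix c z assume "z \<in> R.span S + i_times C (R.span S)"
      then obtain x y where xy: "x \<in> R.span S" "y \<in> R.span S" "z = x + smul C \<i> y"
        by (elim complexification_cases)
      \<comment> \<open>The usual product of complex numbers, with \<open>c\<close> split into real
        and imaginary part by \<open>smul_complex\<close>.\<close>
      have "smul C c z = (smul R (Re c) x - smul R (Im c) y) +
          smul C \<i> (smul R (Im c) x + smul R (Re c) y)"
        unfolding xy(3) C.scale_right_distrib smul_complex[of c x] smul_complex[of c "smul C \<i> y"]
          smul_real_i smul_ii by simp
      then show "smul C c z \<in> R.span S + i_times C (R.span S)"
        using xy complexificationI R.span_add R.span_diff R.span_scale by simp
    qed
  qed
qed

text \<open>Rests on independence of the blades over the complex numbers: an element that is both
  real and \<i> times a real one yields a complex linear relation between blades, whose coefficients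
  must vanish.\<close>

lemma carrier_Int_i_times: "carrier R \<inter> i_times C (carrier R) = {0}"
proof (intro equalityI subsetI)
  fix z assume "z \<in> carrier R \<inter> i_times C (carrier R)"
  then obtain w where z: "z \<in> carrier R" and w: "w \<in> carrier R" "z = smul C \<i> w"
    by (auto simp: i_times_def)
  let ?B = "blade C ` Pow {1..p+q}"
  have B: "finite ?B" by simp
  obtain u v where u: "z = (\<Sum>b\<in>?B. smul R (u b) b)" and v: "w = (\<Sum>b\<in>?B. smul R (v b) b)"
    using z w(1) unfolding R.blade_span blade_real_form R.span_finite[OF B] by auto
  \<comment> \<open>The real coefficients of \<open>z\<close> and \<open>w\<close> are merged into
    complex ones; the real part of each is \<open>u b\<close>, so its vanishing kills
    \<open>z\<close>.\<close>
  have "(\<Sum>b\<in>?B. smul C (u b - \<i> * v b) b) = z - smul C \<i> w"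
    unfolding u v C.scale_sum_right sum_subtractf[symmetric]
    by (intro sum.cong) (simp_all add: real_form_sel C.scale_left_diff_distrib)
  then have "(\<Sum>b\<in>?B. smul C (u b - \<i> * v b) b) = 0"
    using w(2) by simp
  then have "u b - \<i> * v b = 0" if "b \<in> ?B" for b
    by (rule C.independentD[OF C.blade_independent B subset_refl _ that])
  then have "u b = 0" if "b \<in> ?B" for b
    using that by (force simp: complex_eq_iff)
  then show "z \<in> {0}"
    unfolding u by (simp add: sum.neutral)
next
  fix z :: 'b assume "z \<in> {0}"
  then show "z \<in> carrier R \<inter> i_times C (carrier R)"
    using R.carrier_zero i_timesI[OF R.carrier_zero] by simp
qed

text \<open>The two summands lie in \<open>carrier R\<close> and
  \<open>i_times C (carrier R)\<close>, which meet only in 0.\<close>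

lemma direct_sum_complexification:
  assumes "R.subspace U" "R.subspace V" "U \<subseteq> carrier R" "V \<subseteq> carrier R"
  shows "is_direct_sum (U + i_times C V) U (i_times C V)"
proof -
  have "U \<inter> i_times C V \<subseteq> {0}"
    using assms(3,4) carrier_Int_i_times unfolding i_times_def by blast
  moreover have "0 \<in> U \<inter> i_times C V"
    using R.subspace_0 assms(1,2) i_timesI[of 0 V] by simp
  ultimately show ?thesis by (auto simp: is_direct_sum_def)
qed

text \<open>The closure hypotheses say that \<open>U\<close> and \<open>V\<close> multiply like even
  and odd elements, which is how real and imaginary scalars multiply as well. Taking
  \<open>V\<close> equal to \<open>U\<close> covers the complex even part, and taking
  \<open>V\<close> odd covers the mixed case.\<close>

lemma subalgebra_complexification:
  assumes U: "R.subspace U" and V: "R.subspace V"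
    and sub: "U \<subseteq> carrier R" "V \<subseteq> carrier R"
    and closed: "\<And>x y. x \<in> U \<Longrightarrow> y \<in> U \<Longrightarrow> mult R x y \<in> U"
      "\<And>x y. x \<in> U \<Longrightarrow> y \<in> V \<Longrightarrow> mult R x y \<in> V"
      "\<And>x y. x \<in> V \<Longrightarrow> y \<in> U \<Longrightarrow> mult R x y \<in> V"
      "\<And>x y. x \<in> V \<Longrightarrow> y \<in> V \<Longrightarrow> mult R x y \<in> U"
  shows "is_subalgebra (U + i_times C V) (restrict_real C)"
proof -
  have subC: "U \<subseteq> carrier C" "V \<subseteq> carrier C" using sub real_form_subset by auto
  have "U + i_times C V \<subseteq> carrier C"
  proof
    fix z assume "z \<in> U + i_times C V"
    then obtain x y where "x \<in> U" "y \<in> V" "z = x + smul C \<i> y" by (rule complexification_cases)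
    then show "z \<in> carrier C" using subC C.carrier_add C.carrier_smul by blast
  qed
  moreover have "R.subspace (U + i_times C V)"
    unfolding R.subspace_def
  proof (intro conjI ballI allI)
    show "0 \<in> U + i_times C V"
      using complexificationI[of 0 U 0 V] R.subspace_0 U V by simp
  next
    fix z w assume "z \<in> U + i_times C V" "w \<in> U + i_times C V"
    then obtain x y x' y' where xy: "x \<in> U" "y \<in> V" "z = x + smul C \<i> y"
      "x' \<in> U" "y' \<in> V" "w = x' + smul C \<i> y'"
      by (elim complexification_cases) blast
    have eq: "z + w = (x + x') + smul C \<i> (y + y')"
      by (simp add: xy C.scale_right_distrib algebra_simps)
    then show "z + w \<in> U + i_times C V"
      unfolding eq using xy by (intro complexificationI R.subspace_add[OF U] R.subspace_add[OF V])
  next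
    fix r z assume "z \<in> U + i_times C V"
    then obtain x y where xy: "x \<in> U" "y \<in> V" "z = x + smul C \<i> y"
      by (rule complexification_cases)
    have "smul R r z = smul R r x + smul C \<i> (smul R r y)"
      unfolding xy(3) R.scale_right_distrib smul_real_i ..
    then show "smul R r z \<in> U + i_times C V"
      using xy complexificationI R.subspace_scale[OF U] R.subspace_scale[OF V] by simp
  qed
  moreover have "mult C z w \<in> U + i_times C V" if zw: "z \<in> U + i_times C V" "w \<in> U + i_times C V" for z w
  proof -
    obtain x y x' y' where xy: "x \<in> U" "y \<in> V" "z = x + smul C \<i> y"
      "x' \<in> U" "y' \<in> V" "w = x' + smul C \<i> y'"
      using zw by (elim complexification_cases) blast
    note cl = subsetD[OF subC(1) xy(1)] subsetD[OF subC(2) xy(2)]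
      subsetD[OF subC(1) xy(4)] subsetD[OF subC(2) xy(5)]
    \<comment> \<open>The minus sign is the square of \<i>. The first bracket uses the products
      landing in \<open>U\<close>, the second the mixed products landing in
      \<open>V\<close>.\<close>
    have "mult C z w = (mult C x x' - mult C y y') + smul C \<i> (mult C x y' + mult C y x')"
      unfolding xy(3,6) using cl
      by (simp add: C.mult_add_left C.mult_add_right C.mult_smul_left C.mult_smul_right
          C.carrier_add C.carrier_smul C.mult_closed C.scale_right_distrib algebra_simps)
    moreover have "mult C x x' - mult C y y' \<in> U" "mult C x y' + mult C y x' \<in> V"
      using closed xy R.subspace_diff[OF U] R.subspace_add[OF V] by (simp_all add: real_form_sel)
    ultimately show ?thesis using complexificationI by simp
  qed
  ultimately show ?thesis
    by (simp add: is_subalgebra_def smul_restrict_real) (simp add: restrict_real_def)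
qed

text \<open>Both even parts are spans of the same even blades, over different fields, so
  \<open>complex_span\<close> applies.\<close>

lemma even_part_complex:
  "even_part (p+q) C = even_part (p+q) R + i_times C (even_part (p+q) R)"
  unfolding even_part_def C.graded_sum_eq R.graded_sum_eq blade_real_form by (rule complex_span)

end

section \<open>The even subalgebra and the four subalgebras of the complex algebra\<close>

theorem theorem1:
  fixes p q n :: nat
    and A :: "(real, 'a::ab_group_add) gen_algebra"
    and C :: "(complex, 'b::ab_group_add) gen_algebra"
  assumes "n = p + q" and "n \<ge> 1"
  shows "(clifford_algebra A p q \<longrightarrow>
      quat n A 0 + quat n A 2 = even_part n A \<and>
      is_subalgebra (quat n A 0 + quat n A 2) A) \<and>
    (clifford_algebra C p q \<longrightarrow>
      (let R = real_form n C;
           bar02 = quat n R 0 + quat n R 2;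
           bar13 = quat n R 1 + quat n R 3;
           bar0123 = quat n R 0 + quat n R 1 + quat n R 2 + quat n R 3
       in
         (bar02 = even_part n R \<and>
          is_subalgebra bar02 (restrict_real C)) \<and>
         (is_direct_sum (even_part n C) bar02 (i_times C bar02) \<and>
          is_subalgebra (bar02 + i_times C bar02) (restrict_real C)) \<and>
         (is_direct_sum (even_part n R + i_times C (odd_part n R)) bar02 (i_times C bar13) \<and>
          is_subalgebra (bar02 + i_times C bar13) (restrict_real C)) \<and>
         (bar0123 = carrier R \<and>
          is_subalgebra bar0123 (restrict_real C))))"
proof (intro conjI impI)
  assume "clifford_algebra A p q"
  then interpret A: clifford_algebra A p q .
  show "quat n A 0 + quat n A 2 = even_part n A"
    unfolding assms(1) by (rule A.quat_even)
  show "is_subalgebra (quat n A 0 + quat n A 2) A"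
    unfolding assms(1) A.quat_even by (rule A.even_part_subalgebra)
next
  assume "clifford_algebra C p q"
  then interpret complex_clifford_algebra C p q
    by (simp add: complex_clifford_algebra_def)
  \<comment> \<open>Serves the last conjunct, where \<open>R.quat_all\<close> turns
    \<open>bar0123\<close> into the carrier of the real form.\<close>
  have "is_subalgebra (carrier R) R"
    by (simp add: is_subalgebra_def R.carrier_subspace R.mult_closed)
  then show "let R = real_form n C;
           bar02 = quat n R 0 + quat n R 2;
           bar13 = quat n R 1 + quat n R 3;
           bar0123 = quat n R 0 + quat n R 1 + quat n R 2 + quat n R 3
       in
         (bar02 = even_part n R \<and>
          is_subalgebra bar02 (restrict_real C)) \<and>
         (is_direct_sum (even_part n C) bar02 (i_times C bar02) \<and>
          is_subalgebra (bar02 + i_times C bar02) (restrict_real C)) \<and>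
         (is_direct_sum (even_part n R + i_times C (odd_part n R)) bar02 (i_times C bar13) \<and>
          is_subalgebra (bar02 + i_times C bar13) (restrict_real C)) \<and>
         (bar0123 = carrier R \<and>
          is_subalgebra bar0123 (restrict_real C))"
    \<comment> \<open>After rewriting, only the even part, the odd part and the carrier of the real
      form occur. The complexification lemmas are applied with \<open>U\<close> even and
      \<open>V\<close> first even, then odd.\<close>
    unfolding Let_def assms(1) R.quat_even R.quat_odd R.quat_all even_part_complex
    by (intro conjI refl subalgebra_restrict_real R.even_part_subalgebra
        direct_sum_complexification subalgebra_complexification
        R.subspace_parts R.parts_subset_carrier R.mult_parts)
qed

end
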